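(* Let $\mu$ be a finite Borel measure on $\mathbb{R}^d$. If a Borel measure $\nu$ on $\mathbb{R}^d$ is a Bessel measure or a frame measure for $\mu$, then $\nu$ is also a $(p,q)$-Bessel measure for $\mu$ for every $1\le p\le2$, where $q$ is the conjugate exponent to $p$.
   Context: For $t\in\mathbb{R}^d$ let $e_t(x)=e^{2\pi i t\cdot x}$. For a finite Borel measure $\mu$ on $\mathbb{R}^d$, put $\widehat{f d\mu}(t)=\int f(x)e^{-2\pi i t\cdot x}\,d\mu(x)$ for $f\in L^1(\mu)$, $t\in\mathbb{R}^d$. A Borel measure $\nu$ is a Bessel measure for $\mu$ if there is $B>0$ with $\|\widehat{f d\mu}\|_{L^2(\nu)}^2\le B\|f\|_{L^2(\mu)}^2$ for all $f\in L^2(\mu)$; it is a frame measure for $\mu$ if there are $A,B>0$ with $A\|f\|_{L^2(\mu)}^2\le\|\widehat{f d\mu}\|_{L^2(\nu)}^2\le B\|f\|_{L^2(\mu)}^2$ for all $f\in L^2(\mu)$. For $1\le p<\infty$ the compatible semi-inner product on $L^p(\mu)$ is $$[f,g]_{L^p(\mu)}=\frac{1}{\|g\|_{L^p(\mu)}^{p-2}}\int f(x)\,|g(x)|^{p-1}\,\overline{\mathrm{sgn}(g(x))}\,d\mu(x)$$ if $\|g\|_{L^p(\mu)}\neq0$, and $0$ otherwise (where $\mathrm{sgn}(z)=z/|z|$ for $z\ne0$, $\mathrm{sgn}(0)=0$). For conjugate exponents $1<p,q<\infty$, a Borel measure $\nu$ on $\mathbb{R}^d$ is a $(p,q)$-Bessel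 measure for $\mu$ if there is $B>0$ with $\int_{\mathbb{R}^d}|[f,e_t]_{L^p(\mu)}|^q\,d\nu(t)\le B\|f\|_{L^p(\mu)}^q$ for all $f\in L^p(\mu)$. For $p=1$, $q=\infty$, the condition is $\|\widehat{f d\mu}\|_\infty\le B\|f\|_{L^1(\mu)}$ for all $f\in L^1(\mu)$, where $\|\cdot\|_\infty$ is the norm of $L^\infty(\nu)$. *)

theory Defs
  imports "HOL-Probability.Essential_Supremum"
begin

definition expo :: "'a::euclidean_space \<Rightarrow> 'a \<Rightarrow> complex" where
  "expo t x = exp (2 * of_real pi * \<i> * of_real (t \<bullet> x))"

definition fourier :: "'a::euclidean_space measure \<Rightarrow> ('a \<Rightarrow> complex) \<Rightarrow> 'a \<Rightarrow> complex" where
  "fourier \<mu> f t = (LINT x|\<mu>. f x * exp (- (2 * of_real pi * \<i> * of_real (t \<bullet> x))))"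

text \<open>Elements of \<open>L\<^sup>p\<close> are represented by functions, without passing to the quotient by
  almost-everywhere equality. \<open>Lp_norm\<close> is meaningful only on \<open>Lp_space\<close>; norms that may be
  infinite are written as \<open>ennreal\<close>-valued integrals below.\<close>

definition Lp_space :: "real \<Rightarrow> 'a measure \<Rightarrow> ('a \<Rightarrow> complex) set" where
  "Lp_space p M = {f \<in> borel_measurable M. integrable M (\<lambda>x. norm (f x) powr p)}"

definition Lp_norm :: "real \<Rightarrow> 'a measure \<Rightarrow> ('a \<Rightarrow> complex) \<Rightarrow> real" where
  "Lp_norm p M f = (LINT x|M. norm (f x) powr p) powr (1 / p)"

text \<open>For \<open>p = 1\<close> and \<open>g x = 0\<close> the value of \<open>0 powr 0\<close> is irrelevant, since \<open>sgn 0 = 0\<close>.\<close>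

definition semi_inner :: "real \<Rightarrow> 'a measure \<Rightarrow> ('a \<Rightarrow> complex) \<Rightarrow> ('a \<Rightarrow> complex) \<Rightarrow> complex" where
  "semi_inner p M f g =
    (if Lp_norm p M g \<noteq> 0
     then of_real (1 / Lp_norm p M g powr (p - 2)) *
       (LINT x|M. f x * of_real (norm (g x) powr (p - 1)) * cnj (sgn (g x)))
     else 0)"

definition bessel_measure :: "'a::euclidean_space measure \<Rightarrow> 'a measure \<Rightarrow> bool" where
  "bessel_measure \<mu> \<nu> \<longleftrightarrow> sets \<nu> = sets borel \<and>
    (\<exists>B>0. \<forall>f\<in>Lp_space 2 \<mu>.
      (\<integral>\<^sup>+t. ennreal (norm (fourier \<mu> f t) ^ 2) \<partial>\<nu>) \<le> ennreal (B * Lp_norm 2 \<mu> f ^ 2))"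

definition frame_measure :: "'a::euclidean_space measure \<Rightarrow> 'a measure \<Rightarrow> bool" where
  "frame_measure \<mu> \<nu> \<longleftrightarrow> sets \<nu> = sets borel \<and>
    (\<exists>A>0. \<exists>B>0. \<forall>f\<in>Lp_space 2 \<mu>.
      ennreal (A * Lp_norm 2 \<mu> f ^ 2) \<le> (\<integral>\<^sup>+t. ennreal (norm (fourier \<mu> f t) ^ 2) \<partial>\<nu>) \<and>
      (\<integral>\<^sup>+t. ennreal (norm (fourier \<mu> f t) ^ 2) \<partial>\<nu>) \<le> ennreal (B * Lp_norm 2 \<mu> f ^ 2))"

text \<open>In \<open>ennreal\<close> we have \<open>1 / \<infinity> = 0\<close>, so \<open>p = 1\<close> is conjugate exactly to \<open>q = \<infinity>\<close>.\<close>

definition conjugate_exponents :: "real \<Rightarrow> ennreal \<Rightarrow> bool" where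
  "conjugate_exponents p q \<longleftrightarrow> 1 \<le> p \<and> 1 \<le> q \<and> 1 / ennreal p + 1 / q = 1"

text \<open>The essential supremum is taken in \<open>ennreal\<close>, whose least element is \<open>0\<close>; hence it is the
  \<open>L\<^sup>\<infinity>\<close> norm also when \<open>\<nu>\<close> is the zero measure.\<close>

definition pq_bessel_measure ::
    "real \<Rightarrow> ennreal \<Rightarrow> 'a::euclidean_space measure \<Rightarrow> 'a measure \<Rightarrow> bool" where
  "pq_bessel_measure p q \<mu> \<nu> \<longleftrightarrow> conjugate_exponents p q \<and> sets \<nu> = sets borel \<and>
    (if q = \<infinity>
     then \<exists>B>0. \<forall>f\<in>Lp_space 1 \<mu>.
       esssup \<nu> (\<lambda>t. ennreal (norm (fourier \<mu> f t))) \<le> ennreal (B * Lp_norm 1 \<mu> f)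
     else \<exists>B>0. \<forall>f\<in>Lp_space p \<mu>.
       (\<integral>\<^sup>+t. ennreal (norm (semi_inner p \<mu> f (expo t)) powr enn2real q) \<partial>\<nu>)
         \<le> ennreal (B * Lp_norm p \<mu> f powr enn2real q))"

end

theory Submission
  imports Defs
begin

text \<open>
  Every frame measure is a Bessel measure. For a Bessel measure \<open>\<nu>\<close>, the map
  \<open>f \<mapsto> fourier \<mu> f\<close> is bounded from \<open>L\<^sup>2(\<mu>)\<close> to \<open>L\<^sup>2(\<nu>)\<close>, and it is always a contraction from
  \<open>L\<^sup>1(\<mu>)\<close> to \<open>L\<^sup>\<infinity>(\<nu>)\<close>. Interpolation gives boundedness from \<open>L\<^sup>p(\<mu>)\<close> to \<open>L\<^sup>q(\<nu>)\<close> for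
  \<open>1 < p < 2\<close>. Since \<open>\<bar>e\<^sub>t\<bar> = 1\<close>, the modulus of the semi-inner product \<open>[f, e\<^sub>t]\<close> is that of
  \<open>fourier \<mu> f t\<close> times a constant that depends neither on \<open>f\<close> nor on \<open>t\<close> (\<open>semi_inner_expo\<close>),
  so this is the claim.

  The size of the Bessel constant is irrelevant, so the Riesz-Thorin theorem and its complex
  analysis can be replaced by a real-variable argument in the style of Marcinkiewicz. Put
  \<open>N = \<integral> \<bar>f\<bar>\<^sup>p d\<mu>\<close>. For each level \<open>l > 0\<close>, the function \<open>f\<close> is cut at the height where
  \<open>l * \<bar>f\<bar> powr (p - 1) = 2 * N\<close>. The large part has \<open>L\<^sup>1\<close> norm at most \<open>l / 2\<close>, hence contributes
  at most \<open>l / 2\<close> to the transform everywhere. So where the transform of \<open>f\<close> is at least \<open>l\<close>, that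
  of the small part is at least \<open>l / 2\<close>, and Chebyshev's inequality with the \<open>L\<^sup>2\<close> bound controls
  the measure of this set (\<open>emeasure_level_set_le\<close>). Integrating against \<open>q * l powr (q - 1)\<close>
  (\<open>nn_integral_powr_layer_cake\<close>) and exchanging the order of integration leaves, for each \<open>x\<close>, the
  integral of \<open>l powr (q - 3)\<close> up to \<open>2 * N / \<bar>f x\<bar> powr (p - 1)\<close>. It converges because \<open>q > 2\<close>, and
  since \<open>2 - (p - 1) * (q - 2) = p\<close> the result is a multiple of
  \<open>N powr (q - 2) * \<integral> \<bar>f\<bar>\<^sup>p d\<mu> = N powr (q / p)\<close> (\<open>strong_type\<close>).
  The endpoints \<open>p = 1\<close> and \<open>p = 2\<close> are the two given bounds.
\<close>

section \<open>The layer cake formula\<close>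

lemma nn_integral_powr_from_0:
  fixes a c :: real
  assumes "a > -1" "c \<ge> 0"
  shows "(\<integral>\<^sup>+l. ennreal (l powr a) * indicator {0..c} l \<partial>lborel) = ennreal (c powr (a + 1) / (a + 1))"
proof -
  have "((\<lambda>l. if l \<in> {0..c} then l powr a else 0) has_integral (c powr (a + 1) / (a + 1))) UNIV"
    using has_integral_powr_from_0[OF assms] by (simp only: has_integral_restrict_UNIV)
  also have "(\<lambda>l. if l \<in> {0..c} then l powr a else 0) = (\<lambda>l. indicator {0..c} l * l powr a)"
    by (auto simp: indicator_def)
  finally have "(\<integral>\<^sup>+l. ennreal (indicator {0..c} l * l powr a) \<partial>lborel) = ennreal (c powr (a + 1) / (a + 1))"
    by (intro nn_integral_has_integral_lborel) auto
  then show ?thesis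
    by (simp add: ennreal_mult' ennreal_indicator mult.commute)
qed

text \<open>
  The usual formula follows from Tonelli's theorem, which needs a \<open>\<sigma>\<close>-finite measure. A Bessel
  measure need not be one (for \<open>\<mu> = 0\<close> every \<open>\<nu>\<close> is a Bessel measure), but finiteness of the level
  sets makes the restriction to the set where \<open>g\<close> does not vanish \<open>\<sigma>\<close>-finite, and only that
  set contributes to either side.
\<close>

lemma nn_integral_powr_layer_cake:
  fixes g :: "'a \<Rightarrow> real"
  assumes g[measurable]: "g \<in> borel_measurable M" and g0: "\<And>x. 0 \<le> g x" and q: "0 < q"
    and fin: "\<And>l. 0 < l \<Longrightarrow> emeasure M {x \<in> space M. l \<le> g x} < \<infinity>"
  shows "(\<integral>\<^sup>+x. ennreal (g x powr q) \<partial>M) =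
    (\<integral>\<^sup>+l. ennreal (q * l powr (q - 1)) * indicator {0<..} l * emeasure M {x \<in> space M. l \<le> g x} \<partial>lborel)"
proof -
  define D where "D = {x \<in> space M. 0 < g x}"
  define R where "R = restrict_space M D"
  have D[measurable]: "D \<in> sets M" by (simp add: D_def)
  have spR: "space R = D"
    using sets.sets_into_space[OF D] by (auto simp: R_def space_restrict_space)
  have gR[measurable]: "g \<in> borel_measurable R"
    unfolding R_def by (intro measurable_restrict_space1 g)
  have emR: "emeasure R {x \<in> space R. l \<le> g x} = emeasure M {x \<in> space M. l \<le> g x}" if "0 < l" for l
  proof -
    have "{x \<in> space R. l \<le> g x} = {x \<in> space M. l \<le> g x}"
      using that by (auto simp: spR D_def)
    moreover have "{x \<in> space M. l \<le> g x} \<subseteq> D" using that by (auto simp: D_def)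
    ultimately show ?thesis
      by (simp add: R_def emeasure_restrict_space)
  qed
  interpret R: sigma_finite_measure R
  proof
    define A where "A n = {x \<in> space R. 1 / real (Suc n) \<le> g x}" for n
    have "\<Union> (range A) = space R"
    proof (intro equalityI subsetI)
      fix x assume x: "x \<in> space R"
      then have "0 < g x" by (simp add: spR D_def)
      then obtain n where "inverse (real (Suc n)) < g x"
        using reals_Archimedean by blast
      then show "x \<in> \<Union> (range A)" using x by (auto simp: A_def inverse_eq_divide intro!: exI[of _ n])
    qed (auto simp: A_def)
    moreover have "emeasure R (A n) \<noteq> \<infinity>" for n
      unfolding A_def using fin[of "1 / real (Suc n)"] by (subst emR) auto
    moreover have "range A \<subseteq> sets R" by (auto simp: A_def)
    ultimately show "\<exists>F. countable F \<and> F \<subseteq> sets R \<and> \<Union> F = space R \<and> (\<forall>a\<in>F. emeasure R a \<noteq> \<infinity>)"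
      by (intro exI[of _ "range A"]) auto
  qed
  interpret P: pair_sigma_finite lborel R ..
  have "(\<integral>\<^sup>+x. ennreal (g x powr q) \<partial>M) = (\<integral>\<^sup>+x. ennreal (g x powr q) * indicator D x \<partial>M)"
    using g0 by (intro nn_integral_cong) (auto simp: D_def indicator_def less_le)
  also have "\<dots> = (\<integral>\<^sup>+x. ennreal (g x powr q) \<partial>R)"
    unfolding R_def by (subst nn_integral_restrict_space) auto
  also have "\<dots> = (\<integral>\<^sup>+x. (\<integral>\<^sup>+l. ennreal (q * l powr (q - 1)) * indicator {0<..} l *
      indicator {x \<in> space R. l \<le> g x} x \<partial>lborel) \<partial>R)"
  proof (intro nn_integral_cong)
    fix x assume x: "x \<in> space R"
    have "(\<integral>\<^sup>+l. ennreal (q * l powr (q - 1)) * indicator {0<..} l *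
        indicator {x \<in> space R. l \<le> g x} x \<partial>lborel)
      = (\<integral>\<^sup>+l. ennreal q * (ennreal (l powr (q - 1)) * indicator {0..g x} l) \<partial>lborel)"
      using x q by (intro nn_integral_cong) (auto simp: indicator_def ennreal_mult)
    also have "\<dots> = ennreal q * ennreal (g x powr q / q)"
      using nn_integral_powr_from_0[of "q - 1" "g x"] q g0 by (subst nn_integral_cmult) auto
    also have "\<dots> = ennreal (g x powr q)"
      using q by (simp flip: ennreal_mult)
    finally show "ennreal (g x powr q) = (\<integral>\<^sup>+l. ennreal (q * l powr (q - 1)) * indicator {0<..} l *
        indicator {x \<in> space R. l \<le> g x} x \<partial>lborel)" ..
  qed
  also have "\<dots> = (\<integral>\<^sup>+l. (\<integral>\<^sup>+x. ennreal (q * l powr (q - 1)) * indicator {0<..} l *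
      indicator {x \<in> space R. l \<le> g x} x \<partial>R) \<partial>lborel)"
    by (rule P.Fubini') measurable
  also have "\<dots> = (\<integral>\<^sup>+l. ennreal (q * l powr (q - 1)) * indicator {0<..} l * emeasure M {x \<in> space M. l \<le> g x} \<partial>lborel)"
    by (intro nn_integral_cong, subst nn_integral_cmult_indicator)
      (auto simp: indicator_def emR)
  finally show ?thesis .
qed

section \<open>Lebesgue norms and inclusions\<close>

lemma Lp_norm_sq: "Lp_norm 2 M f ^ 2 = (LINT x|M. norm (f x) ^ 2)"
proof -
  have "0 \<le> (LINT x|M. norm (f x) ^ 2)" by simp
  then show ?thesis by (simp add: Lp_norm_def powr_half_sqrt)
qed

lemma Lp_norm_1: "Lp_norm 1 M f = (LINT x|M. norm (f x))"
  by (simp add: Lp_norm_def)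

lemma Lp_space_2D:
  assumes "f \<in> Lp_space 2 M"
  shows "ennreal (Lp_norm 2 M f ^ 2) = (\<integral>\<^sup>+x. ennreal (norm (f x) ^ 2) \<partial>M)"
proof -
  have "integrable M (\<lambda>x. norm (f x) ^ 2)"
    using assms by (simp add: Lp_space_def)
  then show ?thesis
    unfolding Lp_norm_sq by (intro nn_integral_eq_integral[symmetric]) auto
qed

lemma Lp_space_imp_Lp_space_1:
  assumes "finite_measure M" "1 \<le> p" "f \<in> Lp_space p M"
  shows "f \<in> Lp_space 1 M"
proof -
  interpret finite_measure M by fact
  have f[measurable]: "f \<in> borel_measurable M" and i: "integrable M (\<lambda>x. norm (f x) powr p)"
    using assms by (auto simp: Lp_space_def)
  have "norm (f x) \<le> 1 + norm (f x) powr p" for x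
  proof (cases "norm (f x) \<le> 1")
    case False
    then have "norm (f x) powr 1 \<le> norm (f x) powr p"
      using assms(2) by (intro powr_mono) auto
    then show ?thesis by simp
  next
    case True
    have "0 \<le> norm (f x) powr p" by simp
    with True show ?thesis by linarith
  qed
  then have "AE x in M. norm (norm (f x)) \<le> norm (1 + norm (f x) powr p)"
    by (intro AE_I2) (simp add: add_nonneg_nonneg)
  moreover have "integrable M (\<lambda>x. 1 + norm (f x) powr p)"
    using i by simp
  moreover have "(\<lambda>x. norm (f x)) \<in> borel_measurable M" by simp
  ultimately have "integrable M (\<lambda>x. norm (f x))"
    using Bochner_Integration.integrable_bound by blast
  then show ?thesis by (simp add: Lp_space_def)
qed

section \<open>The Fourier transform and the semi-inner product\<close>

lemma fourier_measurable:
  fixes \<mu> \<nu> :: "'a::euclidean_space measure"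
  assumes "finite_measure \<mu>" "sets \<mu> = sets borel" "sets \<nu> = sets borel"
    and f: "f \<in> borel_measurable \<mu>"
  shows "fourier \<mu> f \<in> borel_measurable \<nu>"
proof -
  interpret finite_measure \<mu> by fact
  note [measurable_cong] = assms(2,3)
  note [measurable] = f
  show ?thesis unfolding fourier_def[abs_def]
    by measurable
qed

lemma norm_fourier_le:
  assumes "integrable \<mu> (\<lambda>x. norm (f x))"
  shows "norm (fourier \<mu> f t) \<le> (LINT x|\<mu>. norm (f x))"
proof -
  have "norm (fourier \<mu> f t) \<le> (LINT x|\<mu>. norm (f x * exp (- (2 * of_real pi * \<i> * of_real (t \<bullet> x)))))"
    unfolding fourier_def by (rule integral_norm_bound)
  also have "\<dots> = (LINT x|\<mu>. norm (f x))"
    by (simp add: norm_mult)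
  finally show ?thesis .
qed

lemma fourier_add:
  fixes \<mu> :: "'a::euclidean_space measure"
  assumes [measurable_cong]: "sets \<mu> = sets borel" and "f \<in> Lp_space 1 \<mu>" "g \<in> Lp_space 1 \<mu>"
  shows "fourier \<mu> (\<lambda>x. f x + g x) t = fourier \<mu> f t + fourier \<mu> g t"
proof -
  have "integrable \<mu> (\<lambda>x. h x * exp (- (2 * of_real pi * \<i> * of_real (t \<bullet> x))))"
    if "h \<in> Lp_space 1 \<mu>" for h
  proof (rule Bochner_Integration.integrable_bound)
    have [measurable]: "h \<in> borel_measurable \<mu>" using that by (simp add: Lp_space_def)
    show "integrable \<mu> (\<lambda>x. norm (h x))" using that by (simp add: Lp_space_def)
    show "(\<lambda>x. h x * exp (- (2 * of_real pi * \<i> * of_real (t \<bullet> x)))) \<in> borel_measurable \<mu>"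
      by measurable
  qed (simp add: norm_mult)
  then show ?thesis
    using assms(2,3) by (simp add: fourier_def distrib_right)
qed

text \<open>
  The weight \<open>\<bar>e\<^sub>t\<bar> powr (p - 1)\<close> is \<open>1\<close>, the conjugated sign of \<open>e\<^sub>t\<close> is the Fourier kernel, and
  the norm of \<open>e\<^sub>t\<close> depends only on \<open>p\<close> and the total mass of \<open>\<mu>\<close>.
\<close>

lemma semi_inner_expo:
  fixes \<mu> :: "'a::euclidean_space measure"
  shows "\<exists>c\<ge>0. \<forall>f t. norm (semi_inner p \<mu> f (expo t)) = c * norm (fourier \<mu> f t)"
proof -
  have n: "norm (expo t x) = 1" for t x :: 'a by (simp add: expo_def)
  have s: "cnj (sgn (expo t x)) = exp (- (2 * of_real pi * \<i> * of_real (t \<bullet> x)))" for t x :: 'a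
    by (simp add: sgn_eq n) (simp add: expo_def exp_cnj)
  define L where "L = measure \<mu> (space \<mu>) powr (1 / p)"
  have L: "Lp_norm p \<mu> (expo t) = L" for t by (simp add: Lp_norm_def n L_def)
  show ?thesis
    by (intro exI[of _ "if L \<noteq> 0 then 1 / L powr (p - 2) else 0"])
      (auto simp: semi_inner_def L n s fourier_def norm_mult norm_divide)
qed

section \<open>Interpolation between \<open>L\<^sup>1 \<rightarrow> L\<^sup>\<infinity>\<close> and \<open>L\<^sup>2 \<rightarrow> L\<^sup>2\<close>\<close>

text \<open>
  Subadditivity in modulus is what lets the argument cut a function into two parts and estimate
  each with its own bound. The \<open>L\<^sup>1\<close> bound is normalised to a contraction.
\<close>

locale L1_Linf_L2_L2_operator =
  fixes M :: "'a measure" and \<nu> :: "'b measure"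
    and T :: "('a \<Rightarrow> complex) \<Rightarrow> 'b \<Rightarrow> complex" and B :: real
  assumes fin: "finite_measure M" and B: "0 < B"
    and meas: "f \<in> Lp_space 1 M \<Longrightarrow> T f \<in> borel_measurable \<nu>"
    and subadd: "f \<in> Lp_space 1 M \<Longrightarrow> g \<in> Lp_space 1 M \<Longrightarrow>
      norm (T (\<lambda>x. f x + g x) t) \<le> norm (T f t) + norm (T g t)"
    and L1: "f \<in> Lp_space 1 M \<Longrightarrow> norm (T f t) \<le> Lp_norm 1 M f"
    and L2: "f \<in> Lp_space 2 M \<Longrightarrow>
      (\<integral>\<^sup>+t. ennreal (norm (T f t) ^ 2) \<partial>\<nu>) \<le> ennreal (B * Lp_norm 2 M f ^ 2)"
begin

text \<open>
  The height of the cut is chosen so that the part of \<open>f\<close> outside \<open>S\<close> has \<open>L\<^sup>1\<close> norm at most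
  \<open>l / 2\<close>: there \<open>1 < l / (2 * N) * \<bar>f\<bar> powr (p - 1)\<close>, and multiplying by \<open>\<bar>f\<bar>\<close> bounds \<open>\<bar>f\<bar>\<close> by
  a multiple of \<open>\<bar>f\<bar> powr p\<close>. The part inside \<open>S\<close> is bounded, hence square integrable for a finite
  measure. Writing the cut as \<open>l * \<bar>f\<bar> powr (p - 1) \<le> 2 * N\<close> lets it be solved both for \<open>\<bar>f\<bar>\<close> and
  for \<open>l\<close>; the second form is what the exchange of integrals in \<open>strong_type\<close> uses.
\<close>

lemma emeasure_level_set_le:
  fixes f p l
  defines "N \<equiv> (LINT x|M. norm (f x) powr p)"
  assumes p: "1 < p" and f: "f \<in> Lp_space p M" and N: "0 < N" and l: "0 < l"
  defines "S \<equiv> {x \<in> space M. l * norm (f x) powr (p - 1) \<le> 2 * N}"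
  shows "emeasure \<nu> {t \<in> space \<nu>. l \<le> norm (T f t)} \<le>
      ennreal (4 * B / l ^ 2) * (\<integral>\<^sup>+x. ennreal (norm (f x) ^ 2) * indicator S x \<partial>M)"
    and "(\<integral>\<^sup>+x. ennreal (norm (f x) ^ 2) * indicator S x \<partial>M) < \<infinity>"
proof -
  interpret finite_measure M by (rule fin)
  have [measurable]: "f \<in> borel_measurable M" and ip: "integrable M (\<lambda>x. norm (f x) powr p)"
    using f by (auto simp: Lp_space_def)
  have S[measurable]: "S \<in> sets M" by (simp add: S_def)
  have f1: "f \<in> Lp_space 1 M"
    using Lp_space_imp_Lp_space_1[OF fin _ f] p by simp
  define small where "small = (\<lambda>x. indicator S x * f x)"
  define large where "large = (\<lambda>x. f x - small x)"
  have [measurable]: "small \<in> borel_measurable M" "large \<in> borel_measurable M"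
    unfolding large_def small_def by measurable
  have le: "norm (small x) \<le> norm (f x)" "norm (large x) \<le> norm (f x)" for x
    by (auto simp: large_def small_def indicator_def)
  have "integrable M (\<lambda>x. norm (f x))"
    using f1 by (simp add: Lp_space_def)
  then have "integrable M (\<lambda>x. norm (small x))" "integrable M (\<lambda>x. norm (large x))"
    using le by (auto intro: Bochner_Integration.integrable_bound[where f="\<lambda>x. norm (f x)"])
  then have in1: "small \<in> Lp_space 1 M" "large \<in> Lp_space 1 M"
    by (simp_all add: Lp_space_def)
  have fdecomp: "norm (T f t) \<le> norm (T small t) + norm (T large t)" for t
    using subadd[OF in1, of t] by (simp add: large_def)
  have sm: "norm (small x) \<le> (2 * N / l) powr (1 / (p - 1))" for x
  proof (cases "x \<in> S")
    case True
    then have "norm (f x) powr (p - 1) \<le> 2 * N / l"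
      using l by (simp add: S_def field_simps)
    then have "(norm (f x) powr (p - 1)) powr (1 / (p - 1)) \<le> (2 * N / l) powr (1 / (p - 1))"
      using p by (intro powr_mono2) auto
    then show ?thesis using p True by (simp add: powr_powr small_def)
  qed (simp add: small_def)
  have "norm (small x) ^ 2 \<le> ((2 * N / l) powr (1 / (p - 1))) ^ 2" for x
    using sm by (intro power_mono) auto
  then have "integrable M (\<lambda>x. norm (small x) ^ 2)"
    by (intro integrable_const_bound[of _ "((2 * N / l) powr (1 / (p - 1)))\<^sup>2"]) auto
  then have in2: "small \<in> Lp_space 2 M"
    by (simp add: Lp_space_def)
  have large: "norm (large x) \<le> l / (2 * N) * norm (f x) powr p" if "x \<in> space M" for x
  proof (cases "x \<in> S")
    case False
    then have *: "1 \<le> l / (2 * N) * norm (f x) powr (p - 1)"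
      using that N by (simp add: S_def field_simps)
    then have "norm (f x) \<le> norm (f x) * (l / (2 * N) * norm (f x) powr (p - 1))"
      using mult_left_mono[OF *, of "norm (f x)"] by simp
    also have "\<dots> = l / (2 * N) * (norm (f x) powr 1 * norm (f x) powr (p - 1))"
      by simp
    also have "\<dots> = l / (2 * N) * norm (f x) powr p"
      unfolding powr_add[symmetric] by simp
    finally show ?thesis using False that by (simp add: large_def small_def)
  qed (use N l in \<open>simp add: large_def small_def\<close>)
  have "Lp_norm 1 M large \<le> (LINT x|M. l / (2 * N) * norm (f x) powr p)"
    unfolding Lp_norm_1 using in1(2) ip large
    by (intro integral_mono) (auto simp: Lp_space_def)
  also have "\<dots> = l / 2" using N by (simp add: N_def)
  finally have T_large: "norm (T large t) \<le> l / 2" for t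
    using L1[OF in1(2), of t] by linarith
  have sq: "(\<integral>\<^sup>+x. ennreal (norm (f x) ^ 2) * indicator S x \<partial>M) = ennreal (Lp_norm 2 M small ^ 2)"
    unfolding Lp_space_2D[OF in2]
    by (intro nn_integral_cong) (auto simp: small_def indicator_def)
  then show "(\<integral>\<^sup>+x. ennreal (norm (f x) ^ 2) * indicator S x \<partial>M) < \<infinity>"
    by simp
  note [measurable] = meas[OF in1(1)] meas[OF f1]
  have "emeasure \<nu> {t \<in> space \<nu>. l \<le> norm (T f t)} = (\<integral>\<^sup>+t. indicator {t \<in> space \<nu>. l \<le> norm (T f t)} t \<partial>\<nu>)"
    by simp
  also have "\<dots> \<le> (\<integral>\<^sup>+t. ennreal (4 / l ^ 2) * ennreal (norm (T small t) ^ 2) \<partial>\<nu>)"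
  proof (intro nn_integral_mono)
    fix t assume "t \<in> space \<nu>"
    show "indicator {t \<in> space \<nu>. l \<le> norm (T f t)} t \<le> ennreal (4 / l ^ 2) * ennreal (norm (T small t) ^ 2)"
    proof (cases "l \<le> norm (T f t)")
      case True
      then have "l / 2 \<le> norm (T small t)"
        using fdecomp[of t] T_large[of t] by linarith
      then have "(l / 2) ^ 2 \<le> norm (T small t) ^ 2"
        using l by (intro power_mono) auto
      then have "1 \<le> 4 / l ^ 2 * norm (T small t) ^ 2"
        using l by (simp add: field_simps)
      then have "ennreal 1 \<le> ennreal (4 / l ^ 2 * norm (T small t) ^ 2)"
        by (rule ennreal_leI)
      then show ?thesis by (simp add: indicator_def flip: ennreal_mult)
    qed simp
  qed
  also have "\<dots> = ennreal (4 / l ^ 2) * (\<integral>\<^sup>+t. ennreal (norm (T small t) ^ 2) \<partial>\<nu>)"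
    by (intro nn_integral_cmult) measurable
  also have "\<dots> \<le> ennreal (4 / l ^ 2) * ennreal (B * Lp_norm 2 M small ^ 2)"
    by (intro mult_left_mono L2 in2) simp
  also have "\<dots> = ennreal (4 * B / l ^ 2) * ennreal (Lp_norm 2 M small ^ 2)"
    using B by (simp flip: ennreal_mult)
  finally show "emeasure \<nu> {t \<in> space \<nu>. l \<le> norm (T f t)} \<le>
      ennreal (4 * B / l ^ 2) * (\<integral>\<^sup>+x. ennreal (norm (f x) ^ 2) * indicator S x \<partial>M)"
    unfolding sq .
qed

text \<open>
  The inner integral over the levels converges at \<open>0\<close> only for \<open>q > 2\<close>, which is why \<open>p = 2\<close> is
  excluded; the constant \<open>C\<close> blows up as \<open>p\<close> tends to \<open>2\<close>.
\<close>

lemma strong_type: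
  assumes p: "1 < p" "p < 2" and pq: "1 / p + 1 / q = 1"
  shows "\<exists>C>0. \<forall>f\<in>Lp_space p M.
    (\<integral>\<^sup>+t. ennreal (norm (T f t) powr q) \<partial>\<nu>) \<le> ennreal (C * Lp_norm p M f powr q)"
proof -
  interpret finite_measure M by (rule fin)
  define C where "C = 4 * B * q / (q - 2) * 2 powr (q - 2)"
  have q: "q = p / (p - 1)" proof -
    have "q \<noteq> 0" using pq p by auto
    then show ?thesis using pq p by (simp add: field_simps)
  qed
  have q2: "2 < q" using p by (simp add: q field_simps)
  have C: "0 < C" using q2 B by (simp add: C_def)
  have e1: "2 - (p - 1) * (q - 2) = p" using p by (simp add: q field_simps)
  have e2: "q / p = q - 2 + 1" using p by (simp add: q field_simps)
  have "(\<integral>\<^sup>+t. ennreal (norm (T f t) powr q) \<partial>\<nu>) \<le> ennreal (C * Lp_norm p M f powr q)"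
    if f: "f \<in> Lp_space p M" for f
  proof -
    define N where "N = (LINT x|M. norm (f x) powr p)"
    have [measurable]: "f \<in> borel_measurable M" and ip: "integrable M (\<lambda>x. norm (f x) powr p)"
      using f by (auto simp: Lp_space_def)
    have f1: "f \<in> Lp_space 1 M"
      using Lp_space_imp_Lp_space_1[OF fin _ f] p by simp
    note [measurable] = meas[OF f1]
    have "0 \<le> N" by (simp add: N_def)
    then consider "N = 0" | "0 < N" by linarith
    then show ?thesis
    proof cases
      case 1
      \<comment> \<open>For \<open>N = 0\<close> there is no height to cut at, but \<open>f\<close> vanishes almost everywhere and the
        \<open>L\<^sup>1\<close> bound forces \<open>T f\<close> to vanish.\<close>
      then have "AE x in M. norm (f x) powr p = 0"
        using ip by (subst (asm) N_def, subst (asm) integral_nonneg_eq_0_iff_AE) auto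
      then have "Lp_norm 1 M f = 0"
        unfolding Lp_norm_1 by (intro integral_eq_zero_AE) auto
      then have "T f t = 0" for t
        using L1[OF f1, of t] by simp
      then show ?thesis by simp
    next
      case 2
      define S where "S l = {x \<in> space M. l * norm (f x) powr (p - 1) \<le> 2 * N}" for l
      note level = emeasure_level_set_le[OF p(1) f 2[unfolded N_def], folded N_def, folded S_def]
      have em_fin: "emeasure \<nu> {t \<in> space \<nu>. l \<le> norm (T f t)} < \<infinity>" if l: "0 < l" for l
        using level[OF l] by (auto simp: ennreal_mult_less_top intro: le_less_trans)
      interpret P: pair_sigma_finite M lborel ..
      have "(\<integral>\<^sup>+t. ennreal (norm (T f t) powr q) \<partial>\<nu>) =
          (\<integral>\<^sup>+l. ennreal (q * l powr (q - 1)) * indicator {0<..} l *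
            emeasure \<nu> {t \<in> space \<nu>. l \<le> norm (T f t)} \<partial>lborel)"
        using q2 em_fin by (intro nn_integral_powr_layer_cake) auto
      also have "\<dots> \<le> (\<integral>\<^sup>+l. (\<integral>\<^sup>+x. ennreal (4 * B * q * norm (f x) ^ 2) * (ennreal (l powr (q - 3)) * indicator {0<..} l) *
          indicator (S l) x \<partial>M) \<partial>lborel)"
      proof (intro nn_integral_mono)
        fix l :: real
        show "ennreal (q * l powr (q - 1)) * indicator {0<..} l *
            emeasure \<nu> {t \<in> space \<nu>. l \<le> norm (T f t)} \<le>
          (\<integral>\<^sup>+x. ennreal (4 * B * q * norm (f x) ^ 2) * (ennreal (l powr (q - 3)) * indicator {0<..} l) *
          indicator (S l) x \<partial>M)"
        proof (cases "0 < l")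
          case True
          have pw: "l powr (q - 1) / l ^ 2 = l powr (q - 3)"
            using True by (simp add: powr_diff powr_numeral power2_eq_square power3_eq_cube)
          have [measurable]: "S l \<in> sets M" by (simp add: S_def)
          have "ennreal (q * l powr (q - 1)) * emeasure \<nu> {t \<in> space \<nu>. l \<le> norm (T f t)}
              \<le> ennreal (q * l powr (q - 1)) * (ennreal (4 * B / l ^ 2) *
                (\<integral>\<^sup>+x. ennreal (norm (f x) ^ 2) * indicator (S l) x \<partial>M))"
            by (intro mult_left_mono level(1) True) simp
          also have "\<dots> = ennreal (4 * B * q * (l powr (q - 1) / l ^ 2)) *
                (\<integral>\<^sup>+x. ennreal (norm (f x) ^ 2) * indicator (S l) x \<partial>M)"
            unfolding mult.assoc[symmetric] using q2 B
            by (subst ennreal_mult[symmetric]) (simp_all add: field_simps)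
          also have "\<dots> = (\<integral>\<^sup>+x. ennreal (4 * B * q * l powr (q - 3)) * (ennreal (norm (f x) ^ 2) * indicator (S l) x) \<partial>M)"
            unfolding pw by (intro nn_integral_cmult[symmetric]) measurable
          also have "\<dots> = (\<integral>\<^sup>+x. ennreal (4 * B * q * norm (f x) ^ 2) * (ennreal (l powr (q - 3)) * indicator {0<..} l) *
            indicator (S l) x \<partial>M)"
          proof (intro nn_integral_cong)
            fix x
            have "ennreal (4 * B * q * l powr (q - 3)) * ennreal (norm (f x) ^ 2) =
                ennreal (4 * B * q * norm (f x) ^ 2) * ennreal (l powr (q - 3))"
              using q2 B by (simp add: mult.commute mult.left_commute flip: ennreal_mult)
            then show "ennreal (4 * B * q * l powr (q - 3)) * (ennreal (norm (f x) ^ 2) * indicator (S l) x) =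
                ennreal (4 * B * q * norm (f x) ^ 2) * (ennreal (l powr (q - 3)) * indicator {0<..} l) * indicator (S l) x"
              using True by (simp add: mult.assoc[symmetric])
          qed
          finally show ?thesis using True by simp
        qed simp
      qed
      also have "\<dots> = (\<integral>\<^sup>+x. (\<integral>\<^sup>+l. ennreal (4 * B * q * norm (f x) ^ 2) * (ennreal (l powr (q - 3)) * indicator {0<..} l) *
          indicator (S l) x \<partial>lborel) \<partial>M)"
        unfolding S_def by (rule P.Fubini') measurable
      also have "\<dots> \<le> (\<integral>\<^sup>+x. ennreal (C * N powr (q - 2) * norm (f x) powr p) \<partial>M)"
      proof (intro nn_integral_mono)
        fix x assume x: "x \<in> space M"
        show "(\<integral>\<^sup>+l. ennreal (4 * B * q * norm (f x) ^ 2) * (ennreal (l powr (q - 3)) * indicator {0<..} l) *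
          indicator (S l) x \<partial>lborel) \<le> ennreal (C * N powr (q - 2) * norm (f x) powr p)"
        proof (cases "f x = 0")
          case False
          define c where "c = 2 * N / norm (f x) powr (p - 1)"
          have c: "0 \<le> c" using 2 by (simp add: c_def)
          \<comment> \<open>The cut, solved for the level: \<open>x\<close> belongs to the small part exactly up to \<open>c\<close>.\<close>
          have Sc: "x \<in> S l \<longleftrightarrow> l \<le> c" for l
            using x False by (simp add: S_def c_def field_simps)
          have "(\<integral>\<^sup>+l. ennreal (4 * B * q * norm (f x) ^ 2) * (ennreal (l powr (q - 3)) * indicator {0<..} l) *
            indicator (S l) x \<partial>lborel) =
            (\<integral>\<^sup>+l. ennreal (4 * B * q * norm (f x) ^ 2) * (ennreal (l powr (q - 3)) * indicator {0..c} l) \<partial>lborel)"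
            by (intro nn_integral_cong) (auto simp: indicator_def Sc)
          also have "\<dots> = ennreal (4 * B * q * norm (f x) ^ 2) * ennreal (c powr (q - 2) / (q - 2))"
            using nn_integral_powr_from_0[of "q - 3" c] q2 c
            by (subst nn_integral_cmult) auto
          also have "\<dots> = ennreal (4 * B * q * norm (f x) ^ 2 * (c powr (q - 2) / (q - 2)))"
            using B q2 c by (intro ennreal_mult[symmetric]) auto
          also have "4 * B * q * norm (f x) ^ 2 * (c powr (q - 2) / (q - 2)) =
            C * N powr (q - 2) * (norm (f x) ^ 2 / (norm (f x) powr ((p - 1) * (q - 2))))"
            using 2 by (simp add: c_def C_def powr_divide powr_mult powr_powr mult.commute mult.left_commute)
          also have "norm (f x) ^ 2 / (norm (f x) powr ((p - 1) * (q - 2))) = norm (f x) powr p"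
            using False powr_diff[of "norm (f x)" 2 "(p - 1) * (q - 2)"] by (simp add: e1 powr_numeral)
          finally show ?thesis by simp
        qed simp
      qed
      also have "\<dots> = ennreal (LINT x|M. C * N powr (q - 2) * norm (f x) powr p)"
        using ip C by (intro nn_integral_eq_integral) auto
      also have "(LINT x|M. C * N powr (q - 2) * norm (f x) powr p) = C * (N powr (q - 2) * N)"
        by (simp add: N_def)
      also have "N powr (q - 2) * N = Lp_norm p M f powr q"
      proof -
        have "Lp_norm p M f powr q = N powr (q / p)"
          by (simp add: Lp_norm_def powr_powr flip: N_def)
        then show ?thesis
          using 2 by (simp only: e2 powr_add) simp
      qed
      finally show ?thesis .
    qed
  qed
  with C show ?thesis by blast
qed

end

section \<open>Bessel measures\<close>

lemma conjugate_exponents_1: "conjugate_exponents 1 q \<Longrightarrow> q = \<infinity>"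
proof -
  assume "conjugate_exponents 1 q"
  then have "1 + 1 / q = 1 + 0" by (simp add: conjugate_exponents_def)
  then have "1 / q = 0" by (subst (asm) ennreal_add_left_cancel) simp
  then show "q = \<infinity>" by (simp add: divide_ennreal_def ennreal_inverse_eq_0_iff)
qed

lemma conjugate_exponents_real:
  assumes "conjugate_exponents p q" "1 < p"
  obtains r where "q = ennreal r" "1 \<le> r" "1 / p + 1 / r = 1"
proof -
  have eq: "1 / ennreal p + 1 / q = 1" and q1: "1 \<le> q"
    using assms by (auto simp: conjugate_exponents_def)
  have p: "1 / ennreal p = ennreal (1 / p)"
    using assms(2) by (simp add: divide_ennreal flip: ennreal_1)
  show thesis
  proof (cases q)
    case (real r)
    have r: "1 \<le> r" using q1 real by (simp add: ennreal_1[symmetric] del: ennreal_1)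
    have "1 / q = ennreal (1 / r)"
      using r real by (simp add: divide_ennreal flip: ennreal_1)
    then have "ennreal (1 / p + 1 / r) = ennreal 1"
      using eq p r assms(2) by simp
    then have "1 / p + 1 / r = 1"
      using r assms(2) by (subst (asm) ennreal_inj) auto
    with real r show thesis by (intro that) auto
  next
    case top
    then have "ennreal (1 / p) = ennreal 1" using eq p by (simp add: ennreal_divide_top)
    then have "1 / p = 1" using assms(2) by (subst (asm) ennreal_inj) auto
    then show thesis using assms(2) by simp
  qed
qed

lemma bessel_measure_interpolation:
  fixes \<mu> \<nu> :: "'a::euclidean_space measure"
  assumes fin: "finite_measure \<mu>" and \<mu>: "sets \<mu> = sets borel" and bessel: "bessel_measure \<mu> \<nu>"
    and p: "1 < p" "p \<le> 2" and pr: "1 / p + 1 / r = 1"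
  shows "\<exists>C>0. \<forall>f\<in>Lp_space p \<mu>.
    (\<integral>\<^sup>+t. ennreal (norm (fourier \<mu> f t) powr r) \<partial>\<nu>) \<le> ennreal (C * Lp_norm p \<mu> f powr r)"
proof -
  have \<nu>: "sets \<nu> = sets borel" using bessel by (simp add: bessel_measure_def)
  obtain B where B: "0 < B" and L2: "\<And>f. f \<in> Lp_space 2 \<mu> \<Longrightarrow>
      (\<integral>\<^sup>+t. ennreal (norm (fourier \<mu> f t) ^ 2) \<partial>\<nu>) \<le> ennreal (B * Lp_norm 2 \<mu> f ^ 2)"
    using bessel unfolding bessel_measure_def by blast
  show ?thesis
  proof (cases "p = 2")
    case True
    then have "r = 2" using pr by (simp add: field_simps)
    with True have "\<forall>f\<in>Lp_space p \<mu>.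
        (\<integral>\<^sup>+t. ennreal (norm (fourier \<mu> f t) powr r) \<partial>\<nu>) \<le> ennreal (B * Lp_norm p \<mu> f powr r)"
      using L2 by (simp add: Lp_norm_def)
    with B show ?thesis by blast
  next
    case False
    interpret L1_Linf_L2_L2_operator \<mu> \<nu> "fourier \<mu>" B
    proof (rule L1_Linf_L2_L2_operator.intro)
      show "fourier \<mu> f \<in> borel_measurable \<nu>" if "f \<in> Lp_space 1 \<mu>" for f
        using that by (intro fourier_measurable fin \<mu> \<nu>) (simp add: Lp_space_def)
      show "norm (fourier \<mu> (\<lambda>x. f x + g x) t) \<le> norm (fourier \<mu> f t) + norm (fourier \<mu> g t)"
        if "f \<in> Lp_space 1 \<mu>" "g \<in> Lp_space 1 \<mu>" for f g t
        unfolding fourier_add[OF \<mu> that] by (rule norm_triangle_ineq)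
      show "norm (fourier \<mu> f t) \<le> Lp_norm 1 \<mu> f" if "f \<in> Lp_space 1 \<mu>" for f t
        unfolding Lp_norm_1 by (rule norm_fourier_le) (use that in \<open>simp add: Lp_space_def\<close>)
    qed (fact fin B L2)+
    show ?thesis using strong_type p False pr by simp
  qed
qed

theorem corollary3p13:
  fixes \<mu> \<nu> :: "(real ^ 'd) measure"
  assumes "finite_measure \<mu>" and "sets \<mu> = sets borel"
    and "sets \<nu> = sets borel"
    and "bessel_measure \<mu> \<nu> \<or> frame_measure \<mu> \<nu>"
  shows "\<forall>p q. 1 \<le> p \<and> p \<le> 2 \<and> conjugate_exponents p q \<longrightarrow> pq_bessel_measure p q \<mu> \<nu>"
proof (intro allI impI, elim conjE)
  fix p :: real and q :: ennreal
  assume p: "1 \<le> p" "p \<le> 2" and pq: "conjugate_exponents p q"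
  have bessel: "bessel_measure \<mu> \<nu>"
    using assms(4) unfolding bessel_measure_def frame_measure_def by blast
  show "pq_bessel_measure p q \<mu> \<nu>"
  proof (cases "p = 1")
    case True
    then have q: "q = \<infinity>" using pq conjugate_exponents_1 by simp
    have "esssup \<nu> (\<lambda>t. ennreal (norm (fourier \<mu> f t))) \<le> ennreal (1 * Lp_norm 1 \<mu> f)"
      if f: "f \<in> Lp_space 1 \<mu>" for f
    proof (rule esssup_I)
      have [measurable]: "fourier \<mu> f \<in> borel_measurable \<nu>"
        using f by (intro fourier_measurable assms(1-3)) (simp add: Lp_space_def)
      show "(\<lambda>t. ennreal (norm (fourier \<mu> f t))) \<in> borel_measurable \<nu>"
        by measurable
      have "norm (fourier \<mu> f t) \<le> Lp_norm 1 \<mu> f" for t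
        unfolding Lp_norm_1 by (rule norm_fourier_le) (use f in \<open>simp add: Lp_space_def\<close>)
      then show "AE t in \<nu>. ennreal (norm (fourier \<mu> f t)) \<le> ennreal (1 * Lp_norm 1 \<mu> f)"
        by (simp add: ennreal_leI)
    qed
    then have "\<exists>B>0. \<forall>f\<in>Lp_space 1 \<mu>.
        esssup \<nu> (\<lambda>t. ennreal (norm (fourier \<mu> f t))) \<le> ennreal (B * Lp_norm 1 \<mu> f)"
      by (intro exI[of _ 1]) simp
    then show ?thesis
      unfolding pq_bessel_measure_def using pq q assms(3) by simp
  next
    case False
    with p have p1: "1 < p" by simp
    obtain r where r: "q = ennreal r" "1 \<le> r" "1 / p + 1 / r = 1"
      using conjugate_exponents_real[OF pq p1] .
    have qr: "enn2real q = r" "q \<noteq> \<infinity>" using r by auto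
    obtain C where C: "0 < C" and bound: "\<And>f. f \<in> Lp_space p \<mu> \<Longrightarrow>
        (\<integral>\<^sup>+t. ennreal (norm (fourier \<mu> f t) powr r) \<partial>\<nu>) \<le> ennreal (C * Lp_norm p \<mu> f powr r)"
      using bessel_measure_interpolation[OF assms(1,2) bessel p1 p(2) r(3)] by blast
    obtain c where c: "0 \<le> c"
      and semi: "\<And>f t. norm (semi_inner p \<mu> f (expo t)) = c * norm (fourier \<mu> f t)"
      using semi_inner_expo by blast
    have "(\<integral>\<^sup>+t. ennreal (norm (semi_inner p \<mu> f (expo t)) powr r) \<partial>\<nu>)
        \<le> ennreal ((c powr r + 1) * C * Lp_norm p \<mu> f powr r)" if f: "f \<in> Lp_space p \<mu>" for f
    proof -
      have [measurable]: "fourier \<mu> f \<in> borel_measurable \<nu>"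
        using f by (intro fourier_measurable assms(1-3)) (simp add: Lp_space_def)
      have "(\<integral>\<^sup>+t. ennreal (norm (semi_inner p \<mu> f (expo t)) powr r) \<partial>\<nu>) =
          (\<integral>\<^sup>+t. ennreal (c powr r) * ennreal (norm (fourier \<mu> f t) powr r) \<partial>\<nu>)"
        using c by (simp add: semi powr_mult ennreal_mult)
      also have "\<dots> = ennreal (c powr r) * (\<integral>\<^sup>+t. ennreal (norm (fourier \<mu> f t) powr r) \<partial>\<nu>)"
        by (intro nn_integral_cmult) measurable
      also have "\<dots> \<le> ennreal (c powr r) * ennreal (C * Lp_norm p \<mu> f powr r)"
        by (intro mult_left_mono bound f) simp
      also have "\<dots> = ennreal (c powr r * (C * Lp_norm p \<mu> f powr r))"
        using C by (intro ennreal_mult[symmetric]) auto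
      also have "\<dots> \<le> ennreal ((c powr r + 1) * (C * Lp_norm p \<mu> f powr r))"
        using C by (intro ennreal_leI mult_right_mono) auto
      finally show ?thesis by (simp add: mult.assoc)
    qed
    \<comment> \<open>The constant \<open>c\<close> can be \<open>0\<close> (for \<open>\<mu> = 0\<close>); the added \<open>1\<close> keeps the Bessel constant positive.\<close>
    moreover have "0 < (c powr r + 1) * C"
      using C by (intro mult_pos_pos add_nonneg_pos) auto
    ultimately have "\<exists>B>0. \<forall>f\<in>Lp_space p \<mu>.
        (\<integral>\<^sup>+t. ennreal (norm (semi_inner p \<mu> f (expo t)) powr r) \<partial>\<nu>)
          \<le> ennreal (B * Lp_norm p \<mu> f powr r)"
      by (intro exI[of _ "(c powr r + 1) * C"] conjI ballI)
    then show ?thesis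
      unfolding pq_bessel_measure_def using pq qr assms(3) by simp
  qed
qed

end
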